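(* Let $n\ge1$ be an integer. The distance signless Laplacian spectrum of the friendship graph $F_n$ (the multiset of eigenvalues of $D^Q(F_n)$, superscripts denoting multiplicities) is $$\left\{(4n-5)^{\,n-1},\ (4n-3)^{\,n},\ \lambda_+,\ \lambda_-\right\},\qquad \lambda_\pm=\frac{10n-5\pm\sqrt{36n^2-52n+25}}{2}.$$
   Context: For a connected graph $\Gamma$, the distance matrix is $D(\Gamma)=(d(u,v))_{u,v\in V(\Gamma)}$, where $d$ is the shortest-path distance, and $Tr(\Gamma)$ is the diagonal matrix whose entry at a vertex $v$ is the transmission $\sum_{u\in V(\Gamma)}d(u,v)$. The distance signless Laplacian matrix is $D^Q(\Gamma)=Tr(\Gamma)+D(\Gamma)$. The friendship graph $F_n$ is $K_1\vee(nK_2)$: a single vertex joined to all vertices of $n$ disjoint copies of $K_2$. *)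

theory Defs
  imports
    "Graph_Theory.Graph_Theory"
    "Jordan_Normal_Form.Char_Poly"
begin

text \<open>
  As in \<^theory>\<open>Graph_Theory.Digraph\<close>, a finite simple graph is a finite, symmetric, loop-free
  digraph without parallel arcs, i.e. an instance of \<^locale>\<open>pair_graph\<close>.
\<close>

definition complete_graph :: "nat \<Rightarrow> nat pair_pre_digraph" where
  "complete_graph m = \<lparr> pverts = {..<m}, parcs = {(u, v). u < m \<and> v < m \<and> u \<noteq> v} \<rparr>"

definition graph_copies :: "nat \<Rightarrow> 'a pair_pre_digraph \<Rightarrow> (nat \<times> 'a) pair_pre_digraph" where
  "graph_copies n G =
     \<lparr> pverts = {..<n} \<times> pverts G,
       parcs = {((i, u), (j, v)) | i j u v. i < n \<and> i = j \<and> (u, v) \<in> parcs G} \<rparr>"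

definition graph_join ::
    "'a pair_pre_digraph \<Rightarrow> 'b pair_pre_digraph \<Rightarrow> ('a + 'b) pair_pre_digraph" where
  "graph_join G H =
     \<lparr> pverts = pverts G <+> pverts H,
       parcs = {(Inl u, Inl v) | u v. (u, v) \<in> parcs G}
             \<union> {(Inr u, Inr v) | u v. (u, v) \<in> parcs H}
             \<union> {(Inl u, Inr v) | u v. u \<in> pverts G \<and> v \<in> pverts H}
             \<union> {(Inr v, Inl u) | u v. u \<in> pverts G \<and> v \<in> pverts H} \<rparr>"

definition friendship_graph :: "nat \<Rightarrow> (nat + nat \<times> nat) pair_pre_digraph" where
  "friendship_graph n = graph_join (complete_graph 1) (graph_copies n (complete_graph 2))"

text \<open>
  \<^const>\<open>wf_digraph.\<mu>\<close> is the infimum of the weights of all walks between two vertices; with unit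
  weights it is the length of a shortest path. It is infinite, and the conversion to the reals
  meaningless, for vertices that are not connected.
\<close>

definition graph_dist :: "'a pair_pre_digraph \<Rightarrow> 'a \<Rightarrow> 'a \<Rightarrow> real" where
  "graph_dist G u v = real_of_ereal (wf_digraph.\<mu> (with_proj G) (\<lambda>_. 1) u v)"

definition transmission :: "'a pair_pre_digraph \<Rightarrow> 'a \<Rightarrow> real" where
  "transmission G v = (\<Sum>u\<in>pverts G. graph_dist G u v)"

text \<open>
  Matrices have rows and columns indexed by numbers, so the matrices of a graph are taken with
  respect to a list \<open>vs\<close> that enumerates its vertices without repetition.
\<close>

definition distance_matrix :: "'a pair_pre_digraph \<Rightarrow> 'a list \<Rightarrow> real mat" where
  "distance_matrix G vs =
     mat (length vs) (length vs) (\<lambda>(i, j). graph_dist G (vs ! i) (vs ! j))"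

definition transmission_matrix :: "'a pair_pre_digraph \<Rightarrow> 'a list \<Rightarrow> real mat" where
  "transmission_matrix G vs = mat_diag (length vs) (\<lambda>i. transmission G (vs ! i))"

definition distance_signless_laplacian :: "'a pair_pre_digraph \<Rightarrow> 'a list \<Rightarrow> real mat" where
  "distance_signless_laplacian G vs = transmission_matrix G vs + distance_matrix G vs"

text \<open>
  Eigenvalues are counted with algebraic multiplicity. For the symmetric real matrices considered
  here this is also the geometric one, and all complex eigenvalues are real.
\<close>

definition eigenvalue_mset :: "'a :: field mat \<Rightarrow> 'a multiset" where
  "eigenvalue_mset A = proots (char_poly A)"

lemma complete_digraph_complete_graph:
  "complete_digraph m (with_proj (complete_graph m))"
  unfolding complete_digraph_pair_def by (auto simp: complete_graph_def)

lemma pair_graph_friendship_graph: "pair_graph (friendship_graph n)"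
proof -
  let ?G = "friendship_graph n"
  have sub: "parcs ?G \<subseteq> pverts ?G \<times> pverts ?G"
    by (auto simp: friendship_graph_def graph_join_def graph_copies_def complete_graph_def)
  have fin: "finite (pverts ?G)"
    by (auto simp: friendship_graph_def graph_join_def graph_copies_def complete_graph_def)
  have "sym (parcs ?G)"
    by (rule symI)
      (auto simp: friendship_graph_def graph_join_def graph_copies_def complete_graph_def)
  moreover have "\<And>e. e \<in> parcs ?G \<Longrightarrow> fst e \<noteq> snd e"
    by (auto simp: friendship_graph_def graph_join_def graph_copies_def complete_graph_def)
  moreover have "finite (parcs ?G)"
    using sub fin by (meson finite_SigmaI finite_subset)
  ultimately show ?thesis
    using sub fin by unfold_locales (auto simp: symmetric_def)
qed

lemma connected_friendship_graph: "connected (with_proj (friendship_graph n))"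
proof -
  let ?G = "friendship_graph n"
  let ?c = "Inl 0 :: nat + nat \<times> nat"
  interpret pair_graph ?G
    by (rule pair_graph_friendship_graph)
  have c: "?c \<in> pverts ?G"
    by (auto simp: friendship_graph_def graph_join_def graph_copies_def complete_graph_def)
  have star: "(u = ?c \<or> (u, ?c) \<in> parcs ?G) \<and> (u = ?c \<or> (?c, u) \<in> parcs ?G)"
    if "u \<in> pverts ?G" for u
    using that
    by (auto simp: friendship_graph_def graph_join_def graph_copies_def complete_graph_def)
  have "u \<rightarrow>\<^sup>*\<^bsub>?G\<^esub> ?c" "?c \<rightarrow>\<^sup>*\<^bsub>?G\<^esub> u" if "u \<in> pverts ?G" for u
    using star[OF that] that c by (auto intro: reachable_adjI)
  then have "u \<rightarrow>\<^sup>*\<^bsub>?G\<^esub> v" if "u \<in> pverts ?G" "v \<in> pverts ?G" for u v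
    using that reachable_trans by blast
  then have "u \<rightarrow>\<^sup>*\<^bsub>mk_symmetric (with_proj ?G)\<^esub> v" if "u \<in> pverts ?G" "v \<in> pverts ?G" for u v
    using that by (blast intro: reachable_mk_symmetricI)
  then show ?thesis
    using c unfolding connected_def strongly_connected_def by auto
qed

end

theory Submission
  imports Defs
begin

text \<open>
  Let \<open>c\<close> be the centre of \<open>F\<^sub>n\<close> and call its \<open>2n\<close> neighbours leaves. Two leaves are at distance
  1 if they are partners in one triangle, and at distance 2, via \<open>c\<close>, otherwise. Hence \<open>D\<^sup>Q\<close> acts on
  functions \<open>f\<close> on the vertices, with \<open>s\<close> the sum of \<open>f\<close> over the leaves, by
  \<open>f(c) \<mapsto> 2n f(c) + s\<close> and, at a leaf \<open>u\<close> with partner \<open>u'\<close>, by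
  \<open>f(u) \<mapsto> f(c) + (4n - 4) f(u) - f(u') + 2s\<close> (lemma \<open>signless_action_friendship_graph\<close>).

  The symmetries of \<open>F\<^sub>n\<close> split the function space accordingly. A function that vanishes at \<open>c\<close>, has
  \<open>s = 0\<close> and is antisymmetric on every pair of partners has eigenvalue \<open>4n - 3\<close>; there are \<open>n\<close>
  independent ones. One that is symmetric on the pairs instead has eigenvalue \<open>4n - 5\<close>; there are
  \<open>n - 1\<close> independent ones. What remains are the functions with value \<open>x\<close> at \<open>c\<close> and \<open>y\<close> at all
  leaves, on which \<open>D\<^sup>Q\<close> is \<open>(x, y) \<mapsto> (2n x + 2n y, x + (8n - 5) y)\<close>, with trace \<open>10n - 5\<close> and
  determinant \<open>16n\<^sup>2 - 12n\<close>; its two eigenvalues are \<open>\<lambda>\<^sub>+\<close> and \<open>\<lambda>\<^sub>-\<close>.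

  These functions form a basis, because \<open>\<lambda>\<^sub>+ \<noteq> \<lambda>\<^sub>-\<close> (lemma \<open>friendship_eigenbasis_indep\<close>), and a
  basis of eigenvectors determines the algebraic multiplicities (lemma \<open>eigenvalue_mset_eigenbasis\<close>).
  The basis is indexed by the vertices themselves, so that the argument works for every enumeration
  of the vertices at once.
\<close>

section \<open>Spectra from eigenbases\<close>

lemma sum_nth_distinct:
  assumes "distinct vs"
  shows "(\<Sum>k = 0..<length vs. f (vs ! k)) = sum f (set vs)"
proof -
  have "bij_betw ((!) vs) {0..<length vs} (set vs)"
    using assms by (intro bij_betw_nth) (auto simp: atLeast0LessThan)
  then show ?thesis
    by (rule sum.reindex_bij_betw)
qed

lemma eigenvalue_mset_mat_diag:
  "eigenvalue_mset (mat_diag m f) = (\<Sum>k = 0..<m. {# f k #})"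
proof -
  have "char_poly (mat_diag m f) = (\<Prod>a \<leftarrow> diag_mat (mat_diag m f). [:- a, 1:])"
    by (rule char_poly_upper_triangular[of _ m]) (auto simp: mat_diag_def)
  also have "diag_mat (mat_diag m f) = map f [0..<m]"
    by (auto simp: diag_mat_def mat_diag_def)
  also have "(\<Prod>a \<leftarrow> map f [0..<m]. [:- a, 1:]) = (\<Prod>k = 0..<m. [:- f k, 1:])"
    by (simp add: prod.distinct_set_conv_list[symmetric] comp_def)
  finally show ?thesis
    unfolding eigenvalue_mset_def by (simp add: proots_prod)
qed

text \<open>
  The matrix with columns \<open>P \<cdot> w\<close> has trivial kernel, hence is invertible and conjugates \<open>M\<close> to the
  diagonal matrix of the \<open>\<mu> w\<close>. Rows and columns of \<open>M\<close> and of the eigenvector matrix are both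
  labelled by \<open>'v\<close>, which makes the hypotheses independent of the order of the list \<open>vs\<close>.
\<close>

lemma eigenvalue_mset_eigenbasis:
  fixes M :: "'a :: field mat" and K P :: "'v \<Rightarrow> 'v \<Rightarrow> 'a"
  assumes vs: "distinct vs"
    and M: "M = mat (length vs) (length vs) (\<lambda>(i, j). K (vs ! i) (vs ! j))"
    and eigen: "\<And>u w. u \<in> set vs \<Longrightarrow> w \<in> set vs \<Longrightarrow>
      (\<Sum>v\<in>set vs. K u v * P v w) = \<mu> w * P u w"
    and indep: "\<And>x w. (\<And>u. u \<in> set vs \<Longrightarrow> (\<Sum>v\<in>set vs. P u v * x v) = 0) \<Longrightarrow>
      w \<in> set vs \<Longrightarrow> x w = 0"
  shows "eigenvalue_mset M = (\<Sum>v\<in>set vs. {# \<mu> v #})"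
proof -
  define m where "m = length vs"
  define B where "B = mat m m (\<lambda>(i, j). P (vs ! i) (vs ! j))"
  define T where "T = mat_diag m (\<lambda>i. \<mu> (vs ! i))"
  have carr: "M \<in> carrier_mat m m" "B \<in> carrier_mat m m" "T \<in> carrier_mat m m"
    by (auto simp: M m_def B_def T_def)
  have "M * B = B * T"
  proof (rule eq_matI)
    fix i j assume "i < dim_row (B * T)" "j < dim_col (B * T)"
    then have ij: "i < m" "j < m" using carr by auto
    have "(M * B) $$ (i, j) = (\<Sum>k = 0..<length vs. K (vs ! i) (vs ! k) * P (vs ! k) (vs ! j))"
      using ij carr by (auto simp: scalar_prod_def M B_def m_def intro!: sum.cong)
    also have "\<dots> = \<mu> (vs ! j) * P (vs ! i) (vs ! j)"
      using ij by (simp add: sum_nth_distinct[OF vs, of "\<lambda>v. K (vs ! i) v * P v (vs ! j)"]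
        eigen m_def)
    also have "\<dots> = (B * T) $$ (i, j)"
      using ij unfolding T_def mat_diag_mult_right[OF carr(2)] by (simp add: B_def)
    finally show "(M * B) $$ (i, j) = (B * T) $$ (i, j)" .
  qed (use carr in auto)
  have "det B \<noteq> 0"
  proof
    assume "det B = 0"
    then obtain z where z: "z \<in> carrier_vec m" "z \<noteq> 0\<^sub>v m" "B *\<^sub>v z = 0\<^sub>v m"
      using det_0_iff_vec_prod_zero[OF carr(2)] by blast
    \<comment> \<open>Transport the kernel vector from positions in \<open>vs\<close> to labels, where independence applies.\<close>
    define x where "x v = z $ (THE k. k < m \<and> vs ! k = v)" for v
    have x_nth: "x (vs ! k) = z $ k" if "k < m" for k
    proof -
      have "(THE l. l < m \<and> vs ! l = vs ! k) = k"
        using that vs by (intro the_equality) (auto simp: m_def nth_eq_iff_index_eq)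
      then show ?thesis by (simp add: x_def)
    qed
    have "(\<Sum>v\<in>set vs. P u v * x v) = 0" if u: "u \<in> set vs" for u
    proof -
      obtain i where i: "i < m" "u = vs ! i"
        using u by (auto simp: in_set_conv_nth m_def)
      have "(\<Sum>v\<in>set vs. P u v * x v) = (\<Sum>k = 0..<length vs. P u (vs ! k) * x (vs ! k))"
        by (simp add: sum_nth_distinct[OF vs, of "\<lambda>v. P u v * x v"])
      also have "\<dots> = (B *\<^sub>v z) $ i"
        using i z(1) by (simp add: scalar_prod_def B_def x_nth m_def[symmetric])
      finally show ?thesis using z i by simp
    qed
    then have "x (vs ! k) = 0" if "k < m" for k
      using indep[of x "vs ! k"] that by (auto simp: m_def)
    then have "z = 0\<^sub>v m"
      using z x_nth by (intro eq_vecI) auto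
    with z show False by simp
  qed
  then have "B \<in> Units (ring_mat TYPE('a) m ())"
    by (rule det_non_zero_imp_unit[OF carr(2)])
  then obtain C where C: "C \<in> carrier_mat m m" "C * B = 1\<^sub>m m" "B * C = 1\<^sub>m m"
    by (auto simp: Units_def ring_mat_def)
  have "B * T * C = M * B * C" using \<open>M * B = B * T\<close> by simp
  also have "\<dots> = M * (B * C)" using carr C by (intro assoc_mult_mat) auto
  finally have "M = B * T * C" using carr C by simp
  then have "similar_mat M T"
    using carr C by (intro similar_matI[of _ _ B C m]) auto
  then have "eigenvalue_mset M = eigenvalue_mset T"
    by (simp add: eigenvalue_mset_def char_poly_similar)
  also have "\<dots> = (\<Sum>v\<in>set vs. {# \<mu> v #})"
    unfolding T_def eigenvalue_mset_mat_diag m_def by (rule sum_nth_distinct[OF vs])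
  finally show ?thesis .
qed

section \<open>Small distances in a graph\<close>

context pair_wf_digraph
begin

text \<open>
  The weighted distance is an infimum of walk costs in the extended reals; a walk of minimal length
  attains it.
\<close>

lemma graph_dist_eqI:
  assumes p: "awalk u p v" "length p = k"
    and least: "\<And>q. awalk u q v \<Longrightarrow> k \<le> length q"
  shows "graph_dist G u v = real k"
proof -
  have cost: "awalk_cost (\<lambda>_. 1) q = real (length q)" for q :: "('a \<times> 'a) awalk"
    by (induction q) auto
  have "\<mu> (\<lambda>_. 1) u v = ereal (real k)"
    unfolding \<mu>_def
  proof (rule INF_eqI)
    fix y assume "\<And>q. q \<in> {q. awalk u q v} \<Longrightarrow> y \<le> ereal (awalk_cost (\<lambda>_. 1) q)"
    from this[of p] p show "y \<le> ereal (real k)" by (simp add: cost)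
  qed (use least in \<open>auto simp: cost\<close>)
  then show ?thesis by (simp add: graph_dist_def)
qed

lemma graph_dist_self:
  assumes "u \<in> pverts G"
  shows "graph_dist G u u = 0"
  using graph_dist_eqI[of u "[]" u 0] assms by (simp add: awalk_Nil_iff)

lemma graph_dist_arc:
  assumes "(u, v) \<in> parcs G" "u \<noteq> v"
  shows "graph_dist G u v = 1"
proof -
  have "awalk u [(u, v)] v"
    using assms by (auto simp: awalk_Cons_iff awalk_Nil_iff dest: in_arcsD2)
  moreover have "1 \<le> length q" if "awalk u q v" for q
    using that assms by (cases q) (auto simp: awalk_Nil_iff)
  ultimately show ?thesis
    using graph_dist_eqI[of u "[(u, v)]" v 1] by simp
qed

lemma graph_dist_common_neighbour:
  assumes "(u, w) \<in> parcs G" "(w, v) \<in> parcs G" "u \<noteq> v" "(u, v) \<notin> parcs G"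
  shows "graph_dist G u v = 2"
proof -
  have "awalk u [(u, w), (w, v)] v"
    using assms by (auto simp: awalk_Cons_iff awalk_Nil_iff dest: in_arcsD2)
  moreover have "2 \<le> length q" if q: "awalk u q v" for q
  proof (rule ccontr)
    assume "\<not> 2 \<le> length q"
    then consider "q = []" | e where "q = [e]"
      by (cases q) (auto simp: Suc_le_eq)
    then show False
      using q assms by cases (auto simp: awalk_Nil_iff awalk_Cons_iff)
  qed
  ultimately show ?thesis
    using graph_dist_eqI[of u "[(u, w), (w, v)]" v 2] by simp
qed

end

section \<open>The distance signless Laplacian of the friendship graph\<close>

lemma pverts_friendship_graph:
  "pverts (friendship_graph n) = insert (Inl 0) (Inr ` ({..<n} \<times> {0, 1}))"
  by (auto simp: friendship_graph_def graph_join_def graph_copies_def complete_graph_def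
    less_2_cases_iff)

lemma sum_friendship_graph:
  fixes f :: "nat + nat \<times> nat \<Rightarrow> 'b :: comm_monoid_add"
  shows "sum f (pverts (friendship_graph n)) =
    f (Inl 0) + (\<Sum>i<n. f (Inr (i, 0)) + f (Inr (i, 1)))"
proof -
  have "sum f (pverts (friendship_graph n)) = 
      f (Inl 0) + sum f (Inr ` ({..<n} \<times> {0, 1}))"
    unfolding pverts_friendship_graph by (subst sum.insert) auto
  also have "sum f (Inr ` ({..<n} \<times> {0, 1})) = (\<Sum>p\<in>{..<n} \<times> {0, 1}. f (Inr p))"
    by (subst sum.reindex) auto
  also have "\<dots> = (\<Sum>i<n. \<Sum>b\<in>{0, 1}. f (Inr (i, b)))"
    by (subst sum.cartesian_product) (simp add: case_prod_beta)
  finally show ?thesis by simp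
qed

lemma graph_dist_friendship_graph:
  shows "graph_dist (friendship_graph n) (Inl 0) (Inl 0) = 0"
    and "i < n \<Longrightarrow> a \<in> {0, 1} \<Longrightarrow> graph_dist (friendship_graph n) (Inl 0) (Inr (i, a)) = 1"
    and "i < n \<Longrightarrow> a \<in> {0, 1} \<Longrightarrow> graph_dist (friendship_graph n) (Inr (i, a)) (Inl 0) = 1"
    and "i < n \<Longrightarrow> j < n \<Longrightarrow> a \<in> {0, 1} \<Longrightarrow> b \<in> {0, 1} \<Longrightarrow>
      graph_dist (friendship_graph n) (Inr (i, a)) (Inr (j, b)) =
        (if i \<noteq> j then 2 else if a = b then 0 else 1)"
proof -
  interpret pair_graph "friendship_graph n"
    by (rule pair_graph_friendship_graph)
  note parcs_simps = friendship_graph_def graph_join_def graph_copies_def complete_graph_def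
  show "graph_dist (friendship_graph n) (Inl 0) (Inl 0) = 0"
    by (rule graph_dist_self) (simp add: pverts_friendship_graph)
  show "graph_dist (friendship_graph n) (Inl 0) (Inr (i, a)) = 1"
    if "i < n" "a \<in> {0, 1}"
    using that by (intro graph_dist_arc) (auto simp: parcs_simps)
  show "graph_dist (friendship_graph n) (Inr (i, a)) (Inl 0) = 1"
    if "i < n" "a \<in> {0, 1}"
    using that by (intro graph_dist_arc) (auto simp: parcs_simps)
  show "graph_dist (friendship_graph n) (Inr (i, a)) (Inr (j, b)) =
      (if i \<noteq> j then 2 else if a = b then 0 else 1)"
    if ij: "i < n" "j < n" "a \<in> {0, 1}" "b \<in> {0, 1}"
  proof -
    consider "i \<noteq> j" | "i = j" "a = b" | "i = j" "a \<noteq> b" by blast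
    then show ?thesis
    proof cases
      case 1
      then have "graph_dist (friendship_graph n) (Inr (i, a)) (Inr (j, b)) = 2"
        using ij by (intro graph_dist_common_neighbour[where w = "Inl 0"]) (auto simp: parcs_simps)
      with 1 show ?thesis by simp
    next
      case 2
      then show ?thesis
        using ij graph_dist_self[of "Inr (i, a)"] by (auto simp: pverts_friendship_graph)
    next
      case 3
      then have "graph_dist (friendship_graph n) (Inr (i, a)) (Inr (j, b)) = 1"
        using ij by (intro graph_dist_arc) (auto simp: parcs_simps)
      with 3 show ?thesis by simp
    qed
  qed
qed

text \<open>
  From a leaf every leaf counts with distance 2, up to a correction for the leaf itself
  (distance 0) and for its partner \<open>Inr (i, 1 - a)\<close> (distance 1).
\<close>

lemma distance_action_friendship_graph:
  fixes n :: nat and f :: "nat + nat \<times> nat \<Rightarrow> real"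
  defines "s \<equiv> (\<Sum>i<n. f (Inr (i, 0)) + f (Inr (i, 1)))"
  shows "(\<Sum>v\<in>pverts (friendship_graph n). graph_dist (friendship_graph n) (Inl 0) v * f v) = s"
    and "i < n \<Longrightarrow> a \<in> {0, 1} \<Longrightarrow>
      (\<Sum>v\<in>pverts (friendship_graph n). graph_dist (friendship_graph n) (Inr (i, a)) v * f v) =
        f (Inl 0) + 2 * s - 2 * f (Inr (i, a)) - f (Inr (i, 1 - a))"
proof -
  show "(\<Sum>v\<in>pverts (friendship_graph n). graph_dist (friendship_graph n) (Inl 0) v * f v) = s"
    by (simp add: sum_friendship_graph graph_dist_friendship_graph s_def)
  assume i: "i < n" and a: "a \<in> {0, 1}"
  let ?pair = "\<lambda>j. f (Inr (j, 0)) + f (Inr (j, 1))"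
  have "(\<Sum>v\<in>pverts (friendship_graph n). graph_dist (friendship_graph n) (Inr (i, a)) v * f v) =
      f (Inl 0) + (\<Sum>j<n. 2 * ?pair j - (if j = i then 2 * f (Inr (i, a)) + f (Inr (i, 1 - a)) else 0))"
    unfolding sum_friendship_graph
    using i a by (intro arg_cong2[of _ _ _ _ "(+)"] sum.cong)
      (auto simp: graph_dist_friendship_graph)
  also have "\<dots> = f (Inl 0) + 2 * s - (2 * f (Inr (i, a)) + f (Inr (i, 1 - a)))"
    using i by (simp add: sum_subtractf s_def sum_distrib_left)
  finally show "(\<Sum>v\<in>pverts (friendship_graph n).
      graph_dist (friendship_graph n) (Inr (i, a)) v * f v) =
        f (Inl 0) + 2 * s - 2 * f (Inr (i, a)) - f (Inr (i, 1 - a))"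
    by simp
qed

text \<open>
  A transmission is a column sum of the distance matrix, hence by symmetry the distance action on
  the constant function 1.
\<close>

lemma transmission_friendship_graph:
  shows "transmission (friendship_graph n) (Inl 0) = 2 * real n"
    and "i < n \<Longrightarrow> a \<in> {0, 1} \<Longrightarrow> transmission (friendship_graph n) (Inr (i, a)) = 4 * real n - 2"
proof -
  have sym: "graph_dist (friendship_graph n) u v = graph_dist (friendship_graph n) v u"
    if "u \<in> pverts (friendship_graph n)" "v \<in> pverts (friendship_graph n)" for u v
    using that by (auto simp: pverts_friendship_graph graph_dist_friendship_graph)
  have row: "transmission (friendship_graph n) v =
      (\<Sum>u\<in>pverts (friendship_graph n). graph_dist (friendship_graph n) v u * 1)"
    if "v \<in> pverts (friendship_graph n)" for v
    unfolding transmission_def using that by (intro sum.cong) (auto simp: sym)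
  show "transmission (friendship_graph n) (Inl 0) = 2 * real n"
    by (subst row, simp add: pverts_friendship_graph, subst distance_action_friendship_graph) simp
  show "transmission (friendship_graph n) (Inr (i, a)) = 4 * real n - 2"
    if "i < n" "a \<in> {0, 1}"
    using that by (subst row, force simp: pverts_friendship_graph,
        subst distance_action_friendship_graph) simp_all
qed

definition signless_entry :: "'a pair_pre_digraph \<Rightarrow> 'a \<Rightarrow> 'a \<Rightarrow> real" where
  "signless_entry G u v = (if u = v then transmission G u else 0) + graph_dist G u v"

lemma distance_signless_laplacian_eq_mat:
  assumes "distinct vs"
  shows "distance_signless_laplacian G vs =
    mat (length vs) (length vs) (\<lambda>(i, j). signless_entry G (vs ! i) (vs ! j))"
  by (rule eq_matI)
    (use assms in \<open>auto simp: distance_signless_laplacian_def transmission_matrix_def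
      distance_matrix_def mat_diag_def signless_entry_def nth_eq_iff_index_eq\<close>)

lemma sum_signless_entry:
  assumes "finite (pverts G)" "u \<in> pverts G"
  shows "(\<Sum>v\<in>pverts G. signless_entry G u v * f v) =
    transmission G u * f u + (\<Sum>v\<in>pverts G. graph_dist G u v * f v)"
proof -
  have "(\<Sum>v\<in>pverts G. signless_entry G u v * f v) =
      (\<Sum>v\<in>pverts G. if u = v then transmission G u * f v else 0)
      + (\<Sum>v\<in>pverts G. graph_dist G u v * f v)"
    unfolding sum.distrib[symmetric]
    by (intro sum.cong) (auto simp: signless_entry_def distrib_right)
  then show ?thesis using assms by simp
qed

lemma signless_action_friendship_graph:
  fixes n :: nat and f :: "nat + nat \<times> nat \<Rightarrow> real"
  defines "s \<equiv> (\<Sum>i<n. f (Inr (i, 0)) + f (Inr (i, 1)))"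
  shows "(\<Sum>v\<in>pverts (friendship_graph n). signless_entry (friendship_graph n) (Inl 0) v * f v) =
      2 * real n * f (Inl 0) + s"
    and "i < n \<Longrightarrow> a \<in> {0, 1} \<Longrightarrow>
      (\<Sum>v\<in>pverts (friendship_graph n). signless_entry (friendship_graph n) (Inr (i, a)) v * f v) =
        f (Inl 0) + (4 * real n - 4) * f (Inr (i, a)) - f (Inr (i, 1 - a)) + 2 * s"
proof -
  have fin: "finite (pverts (friendship_graph n))"
    by (simp add: pverts_friendship_graph)
  show "(\<Sum>v\<in>pverts (friendship_graph n). signless_entry (friendship_graph n) (Inl 0) v * f v) =
      2 * real n * f (Inl 0) + s"
    by (subst sum_signless_entry[OF fin])
      (simp_all add: pverts_friendship_graph[symmetric] distance_action_friendship_graph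
        transmission_friendship_graph s_def, simp add: pverts_friendship_graph)
  assume ia: "i < n" "a \<in> {0, 1}"
  then have "Inr (i, a) \<in> pverts (friendship_graph n)"
    unfolding pverts_friendship_graph by blast
  then show "(\<Sum>v\<in>pverts (friendship_graph n).
      signless_entry (friendship_graph n) (Inr (i, a)) v * f v) =
        f (Inl 0) + (4 * real n - 4) * f (Inr (i, a)) - f (Inr (i, 1 - a)) + 2 * s"
    by (simp only: sum_signless_entry[OF fin] distance_action_friendship_graph(2)[OF ia]
        transmission_friendship_graph(2)[OF ia] s_def)
      (simp add: algebra_simps)
qed

section \<open>An eigenbasis\<close>

text \<open>
  The value at vertex \<open>u\<close> of the basis vector with index \<open>w\<close> is \<open>friendship_eigenbasis n l m u w\<close>,
  where \<open>l\<close> and \<open>m\<close> stand for \<open>\<lambda>\<^sub>+\<close> and \<open>\<lambda>\<^sub>-\<close>. The index \<open>Inr (k, 1)\<close> carries the function that is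
  1 and -1 on the \<open>k\<close>-th pair; for \<open>k > 0\<close>, the index \<open>Inr (k, 0)\<close> carries the indicator function of
  the \<open>k\<close>-th pair minus that of the 0-th pair. The two indices left over, the centre and
  \<open>Inr (0, 0)\<close>, carry the functions that are 1 on the leaves and \<open>t - (8n - 5)\<close> at the centre, for
  \<open>t = l\<close> and \<open>t = m\<close>; the value at the centre is forced by the eigenvector equation at a leaf.
\<close>

fun friendship_eigenbasis ::
    "nat \<Rightarrow> real \<Rightarrow> real \<Rightarrow> nat + nat \<times> nat \<Rightarrow> nat + nat \<times> nat \<Rightarrow> real" where
  "friendship_eigenbasis n l m (Inl _) (Inl _) = l - (8 * real n - 5)"
| "friendship_eigenbasis n l m (Inr _) (Inl _) = 1"
| "friendship_eigenbasis n l m (Inl _) (Inr (k, b)) =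
     (if b = 0 \<and> k = 0 then m - (8 * real n - 5) else 0)"
| "friendship_eigenbasis n l m (Inr (i, a)) (Inr (k, b)) =
     (if b = 0 then if k = 0 then 1 else of_bool (i = k) - of_bool (i = 0)
      else of_bool (i = k) * (if a = 0 then 1 else - 1))"

fun friendship_eigenvalue :: "nat \<Rightarrow> real \<Rightarrow> real \<Rightarrow> nat + nat \<times> nat \<Rightarrow> real" where
  "friendship_eigenvalue n l m (Inl _) = l"
| "friendship_eigenvalue n l m (Inr (k, b)) =
     (if b = 0 then if k = 0 then m else 4 * real n - 5 else 4 * real n - 3)"

text \<open>
  The hypotheses on \<open>l\<close> and \<open>m\<close> say that they are roots of the characteristic polynomial of the
  2-by-2 matrix by which \<open>D\<^sup>Q\<close> acts on functions constant on the leaves. They enter through the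
  eigenvector equation at the centre.
\<close>

lemma friendship_eigenbasis_eigen:
  assumes l: "l\<^sup>2 - (10 * real n - 5) * l + (16 * (real n)\<^sup>2 - 12 * real n) = 0"
    and m: "m\<^sup>2 - (10 * real n - 5) * m + (16 * (real n)\<^sup>2 - 12 * real n) = 0"
    and u: "u \<in> pverts (friendship_graph n)" and w: "w \<in> pverts (friendship_graph n)"
  shows "(\<Sum>v\<in>pverts (friendship_graph n).
      signless_entry (friendship_graph n) u v * friendship_eigenbasis n l m v w) =
    friendship_eigenvalue n l m w * friendship_eigenbasis n l m u w"
proof -
  define s where "s = (\<Sum>i<n. friendship_eigenbasis n l m (Inr (i, 0)) w +
    friendship_eigenbasis n l m (Inr (i, 1)) w)"
  have s: "s = (case w of Inl _ \<Rightarrow> 2 * real n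
      | Inr (k, b) \<Rightarrow> if b = 0 \<and> k = 0 then 2 * real n else 0)"
  proof (cases w)
    case (Inr p)
    obtain k b where p: "p = (k, b)" by force
    have k: "k < n" "b \<in> {0, 1}" using w Inr p by (auto simp: pverts_friendship_graph)
    have "(\<Sum>i<n. of_bool (i = k) - of_bool (i = 0) + (of_bool (i = k) - of_bool (i = 0))) = (0 :: real)"
      using k by (simp add: sum.distrib sum_subtractf of_bool_def sum_distrib_left[symmetric])
    then show ?thesis
      using Inr p k by (cases "b = 0"; cases "k = 0") (simp_all add: s_def)
  qed (simp add: s_def)
  note action = signless_action_friendship_graph[where n = n and f = "\<lambda>v. friendship_eigenbasis n l m v w",
      folded s_def]
  have quad: "2 * real n * (t - (8 * real n - 5)) + 2 * real n = t * (t - (8 * real n - 5))"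
    if "t\<^sup>2 - (10 * real n - 5) * t + (16 * (real n)\<^sup>2 - 12 * real n) = 0" for t
    using that by (simp add: algebra_simps power2_eq_square)
  consider "u = Inl 0" | i a where "u = Inr (i, a)" "i < n" "a \<in> {0, 1}"
    using u by (auto simp: pverts_friendship_graph)
  then show ?thesis
  proof cases
    case 1
    then show ?thesis
      using w quad[OF l] quad[OF m] unfolding 1 action(1)
      by (auto simp: s pverts_friendship_graph)
  next
    case (2 i a)
    then show ?thesis
      using w unfolding 2(1) action(2)[OF 2(2,3)]
      by (auto simp: s pverts_friendship_graph algebra_simps)
  qed
qed

text \<open>
  Comparing a vanishing linear combination on the two leaves of a pair isolates the coefficient of
  the antisymmetric vector. Summing it over all pairs removes the differences of indicator
  functions, so the coefficients of the two vectors that are 1 on all leaves add up to 0; their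
  values at the centre differ, and so both coefficients are 0. What is left are the differences of
  indicator functions, and the \<open>k\<close>-th pair sees only the \<open>k\<close>-th of them.
\<close>

lemma friendship_eigenbasis_indep:
  assumes n: "n \<ge> 1" and "l \<noteq> m"
    and zero: "\<And>u. u \<in> pverts (friendship_graph n) \<Longrightarrow>
      (\<Sum>v\<in>pverts (friendship_graph n). friendship_eigenbasis n l m u v * x v) = 0"
    and w: "w \<in> pverts (friendship_graph n)"
  shows "x w = 0"
proof -
  \<comment> \<open>\<open>y k\<close> is the coefficient of the \<open>k\<close>-th difference of indicators; there is none for \<open>k = 0\<close>,
    since \<open>Inr (0, 0)\<close> is the index of the second vector that is constant on the leaves.\<close>
  define y where "y k = (if k = 0 then 0 else x (Inr (k, 0)))" for k
  define c where "c = x (Inl 0) + x (Inr (0, 0))"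
  have sum_b: "(\<Sum>k<n. if k = i then g k else 0) = g i" if "i < n" for i and g :: "nat \<Rightarrow> real"
    using that by simp
  have centre: "(l - (8 * real n - 5)) * x (Inl 0) + (m - (8 * real n - 5)) * x (Inr (0, 0)) = 0"
  proof -
    have "(\<Sum>k<n. friendship_eigenbasis n l m (Inl 0) (Inr (k, 0)) * x (Inr (k, 0)) +
        friendship_eigenbasis n l m (Inl 0) (Inr (k, 1)) * x (Inr (k, 1))) =
      (\<Sum>k<n. if k = 0 then (m - (8 * real n - 5)) * x (Inr (k, 0)) else 0)"
      by (intro sum.cong) auto
    then show ?thesis
      using zero[of "Inl 0"] n unfolding sum_friendship_graph
      by (simp add: pverts_friendship_graph)
  qed
  have leaf: "c + y i - of_bool (i = 0) * (\<Sum>k<n. y k) + (if a = 0 then 1 else - 1) * x (Inr (i, 1)) = 0"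
    if ia: "i < n" "a \<in> {0, 1}" for i a :: nat
  proof -
    have "(\<Sum>k<n. friendship_eigenbasis n l m (Inr (i, a)) (Inr (k, 0)) * x (Inr (k, 0)) +
        friendship_eigenbasis n l m (Inr (i, a)) (Inr (k, 1)) * x (Inr (k, 1))) =
      (\<Sum>k<n. (if k = 0 then x (Inr (k, 0)) else 0) + (if k = i then y k else 0)
        - of_bool (i = 0) * y k
        + (if k = i then (if a = 0 then 1 else - 1) * x (Inr (k, 1)) else 0))"
      by (intro sum.cong) (auto simp: y_def)
    also have "\<dots> = x (Inr (0, 0)) + y i - of_bool (i = 0) * (\<Sum>k<n. y k)
        + (if a = 0 then 1 else - 1) * x (Inr (i, 1))"
      unfolding sum.distrib sum_subtractf sum_distrib_left[symmetric]
      using n ia by (simp add: sum_b)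
    finally show ?thesis
      using zero[of "Inr (i, a)"] ia unfolding sum_friendship_graph
      by (simp add: pverts_friendship_graph c_def image_iff)
  qed
  have x1: "x (Inr (i, 1)) = 0" if "i < n" for i
    using leaf[of i 0] leaf[of i 1] that by simp
  have y: "c + y i = of_bool (i = 0) * (\<Sum>k<n. y k)" if "i < n" for i
    using leaf[of i 0] x1[of i] that by simp
  have "(\<Sum>i<n. c + y i) = (\<Sum>i<n. if i = 0 then \<Sum>k<n. y k else 0)"
    by (intro sum.cong) (auto simp: y)
  then have "c = 0"
    using n by (simp add: sum.distrib)
  then have "(l - m) * x (Inl 0) = 0"
    using centre by (simp add: c_def add_eq_0_iff algebra_simps)
  then have x0: "x (Inl 0) = 0" "x (Inr (0, 0)) = 0"
    using \<open>l \<noteq> m\<close> \<open>c = 0\<close> by (auto simp: c_def)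
  have xk: "x (Inr (k, 0)) = 0" if "k < n" for k
    using y[OF that] \<open>c = 0\<close> x0 by (cases "k = 0") (auto simp: y_def)
  show ?thesis
    using w x0 x1 xk by (auto simp: pverts_friendship_graph)
qed

section \<open>The spectrum\<close>

theorem corollary4p2:
  fixes n :: nat and vs :: "(nat + nat \<times> nat) list"
  assumes "n \<ge> 1"
    and "distinct vs" and "set vs = pverts (friendship_graph n)"
  shows "eigenvalue_mset (distance_signless_laplacian (friendship_graph n) vs) =
      replicate_mset (n - 1) (4 * real n - 5)
      + replicate_mset n (4 * real n - 3)
      + {# (10 * real n - 5 + sqrt (36 * (real n)\<^sup>2 - 52 * real n + 25)) / 2,
           (10 * real n - 5 - sqrt (36 * (real n)\<^sup>2 - 52 * real n + 25)) / 2 #}"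
proof -
  define d where "d = 36 * (real n)\<^sup>2 - 52 * real n + 25"
  define l where "l = (10 * real n - 5 + sqrt d) / 2"
  define m where "m = (10 * real n - 5 - sqrt d) / 2"
  \<comment> \<open>Completing the square shows that the discriminant is positive, so that the roots differ.\<close>
  have "d = (6 * real n - 13 / 3)\<^sup>2 + 56 / 9"
    by (simp add: d_def power2_eq_square algebra_simps)
  then have d: "d > 0"
    by (metis add_nonneg_pos zero_le_power2 divide_pos_pos zero_less_numeral)
  then have "l \<noteq> m"
    by (simp add: l_def m_def)
  have root: "t\<^sup>2 - (10 * real n - 5) * t + (16 * (real n)\<^sup>2 - 12 * real n) = 0"
    if "(2 * t - (10 * real n - 5))\<^sup>2 = d" for t
    using that by (simp add: d_def power2_eq_square algebra_simps)
  have l: "l\<^sup>2 - (10 * real n - 5) * l + (16 * (real n)\<^sup>2 - 12 * real n) = 0"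
    and m: "m\<^sup>2 - (10 * real n - 5) * m + (16 * (real n)\<^sup>2 - 12 * real n) = 0"
    by (rule root, use d in \<open>simp add: l_def m_def diff_divide_distrib add_divide_distrib\<close>)+
  have rep: "(\<Sum>k<r. {# t #}) = replicate_mset r t" for r and t :: real
    by (induction r) auto
  have "eigenvalue_mset (distance_signless_laplacian (friendship_graph n) vs) =
      (\<Sum>v\<in>set vs. {# friendship_eigenvalue n l m v #})"
    using assms(2) distance_signless_laplacian_eq_mat[OF assms(2)]
  proof (rule eigenvalue_mset_eigenbasis)
    show "(\<Sum>v\<in>set vs. signless_entry (friendship_graph n) u v * friendship_eigenbasis n l m v w) =
        friendship_eigenvalue n l m w * friendship_eigenbasis n l m u w"
      if "u \<in> set vs" "w \<in> set vs" for u w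
      using friendship_eigenbasis_eigen[OF l m, of u w] that unfolding assms(3) by simp
    show "x w = 0"
      if "\<And>u. u \<in> set vs \<Longrightarrow> (\<Sum>v\<in>set vs. friendship_eigenbasis n l m u v * x v) = 0"
        and "w \<in> set vs" for x w
      using friendship_eigenbasis_indep[OF assms(1) \<open>l \<noteq> m\<close>, of x w] that unfolding assms(3) by simp
  qed
  also have "\<dots> = {# l #} + (\<Sum>k<n. {# if k = 0 then m else 4 * real n - 5 #}
      + {# 4 * real n - 3 #})"
    unfolding assms(3) sum_friendship_graph by simp
  also have "\<dots> = {# l #} + ((\<Sum>k<n. {# if k = 0 then m else 4 * real n - 5 #})
      + (\<Sum>k<n. {# 4 * real n - 3 #}))"
    by (simp only: sum.distrib)
  also have "\<dots> = {# l, m #} + (\<Sum>k<n - 1. {# 4 * real n - 5 #}) + (\<Sum>k<n. {# 4 * real n - 3 #})"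
    using assms(1)
    by (cases n) (simp_all add: sum.lessThan_Suc_shift del: sum.lessThan_Suc)
  finally show ?thesis
    by (simp add: rep l_def m_def d_def)
qed

end
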